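(* For every pointed integral connectivity space $X$, the endofunctor $X\wedge -$ on $\mathbf{pCnct}$ is left adjoint to the endofunctor $\mathbf{pCnct}(X,-)$.
   Context: A connectivity structure on a set $S$ is a set $\mathcal{K}$ of subsets of $S$ with $\emptyset\in\mathcal{K}$ such that for every $\mathcal{I}\subseteq\mathcal{K}$, if $\bigcap_{K\in\mathcal{I}}K\neq\emptyset$ then $\bigcup_{K\in\mathcal{I}}K\in\mathcal{K}$. It is integral if it contains every singleton. For a set $\mathcal{A}$ of subsets of a set, $[\mathcal{A}]_0$ denotes the smallest (for inclusion) connectivity structure containing $\mathcal{A}$. A pointed integral connectivity space is a triple $X=(|X|,\kappa(X),\beta(X))$ where $\kappa(X)$ is an integral connectivity structure on the set $|X|$ and $\beta(X)\in|X|$ is the base-point. The category $\mathbf{pCnct}$ has these as objects; a morphism $X\to Y$ (a based connecting map) is a function $f:|X|\to|Y|$ with $f(\beta(X))=\beta(Y)$ and $f(K)\in\kappa(Y)$ for all $K\in\kappa(X)$. Tensor product: $X_1\boxtimes X_2$ has carrier $|X_1|\times|X_2|$, base-point $(\beta(X_1),\beta(X_2))$, and connectivity structure $[\{K_1\times K_2: K_i\in\kappa(X_i)\}]_0$. Smash product: let $|X_1\vee X_2|=(|X_1|\times\{\beta(X_2)\})\cup(\{\beta(X_1)\}\times|X_2|)\subseteq|X_1|\times|X_2|$. Then $X_1\wedge X_2=(X_1\boxtimes X_2)/|X_1\vee X_2|$: its carrier is the quotient of $|X_1|\times|X_2|$ by the equivalence relation identifying all points of $|X_1\vee X_2|$ with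 each other (and nothing else); if $s$ is the canonical map onto this quotient, the connectivity structure is $[\{s(K):K\in\kappa(X_1\boxtimes X_2)\}]_0$ and the base-point is $s(\beta(X_1),\beta(X_2))$. Writing $\widetilde{(x,y)}=s(x,y)$, for a morphism $f:Y\to Z$ the morphism $X\wedge f:X\wedge Y\to X\wedge Z$ is $\widetilde{(x,y)}\mapsto\widetilde{(x,f(y))}$. Internal hom: $\mathbf{pCnct}(X_1,X_2)$ has as carrier the set of all morphisms $X_1\to X_2$ in $\mathbf{pCnct}$; a set $M$ of such morphisms is connected iff $\bigcup_{f\in M}f(K)\in\kappa(X_2)$ for every $K\in\kappa(X_1)$; the base-point is the constant map $x\mapsto\beta(X_2)$. For a morphism $g$, $\mathbf{pCnct}(X,g)=g\circ -$. *)

theory Defs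
  imports "HOL-Library.FuncSet"
begin

definition connectivity_structure :: "'a set \<Rightarrow> 'a set set \<Rightarrow> bool" where
  "connectivity_structure S \<K> \<longleftrightarrow>
     \<K> \<subseteq> Pow S \<and> {} \<in> \<K> \<and> (\<forall>\<I>. \<I> \<subseteq> \<K> \<and> \<Inter>\<I> \<noteq> {} \<longrightarrow> \<Union>\<I> \<in> \<K>)"

definition integral_structure :: "'a set \<Rightarrow> 'a set set \<Rightarrow> bool" where
  "integral_structure S \<K> \<longleftrightarrow> connectivity_structure S \<K> \<and> (\<forall>x\<in>S. {x} \<in> \<K>)"

text \<open>The structure \<open>[\<A>]\<^sub>0\<close>, for \<open>\<A>\<close> a set of subsets of \<open>S\<close>; see \<open>generated_structure_least\<close>.\<close>
definition generated_structure :: "'a set \<Rightarrow> 'a set set \<Rightarrow> 'a set set" where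
  "generated_structure S \<A> = \<Inter>{\<K>. connectivity_structure S \<K> \<and> \<A> \<subseteq> \<K>}"

lemma generated_structure_least:
  assumes "\<A> \<subseteq> Pow S"
  shows "connectivity_structure S (generated_structure S \<A>)"
    and "\<A> \<subseteq> generated_structure S \<A>"
    and "\<And>\<K>. connectivity_structure S \<K> \<Longrightarrow> \<A> \<subseteq> \<K> \<Longrightarrow> generated_structure S \<A> \<subseteq> \<K>"
proof -
  have "connectivity_structure S (Pow S)"
    by (auto simp: connectivity_structure_def)
  then have "generated_structure S \<A> \<subseteq> Pow S"
    using assms unfolding generated_structure_def by blast
  moreover have "\<Union>\<I> \<in> generated_structure S \<A>"
    if "\<I> \<subseteq> generated_structure S \<A>" "\<Inter>\<I> \<noteq> {}" for \<I>
    unfolding generated_structure_def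
  proof (rule InterI)
    fix \<K> assume "\<K> \<in> {\<K>. connectivity_structure S \<K> \<and> \<A> \<subseteq> \<K>}"
    then have "connectivity_structure S \<K>" "\<I> \<subseteq> \<K>"
      using that(1) unfolding generated_structure_def by blast+
    then show "\<Union>\<I> \<in> \<K>"
      using that(2) unfolding connectivity_structure_def by blast
  qed
  ultimately show "connectivity_structure S (generated_structure S \<A>)"
    unfolding connectivity_structure_def
    by (auto simp: generated_structure_def connectivity_structure_def)
qed (auto simp: generated_structure_def)

record 'a pspace =
  pts :: "'a set"
  conn :: "'a set set"
  bpt :: 'a

text \<open>The objects of \<open>pCnct\<close> with carrier in the type \<open>'a\<close>.\<close>
definition pCnct :: "'a pspace set" where
  "pCnct = {X. integral_structure (pts X) (conn X) \<and> bpt X \<in> pts X}"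

text \<open>Morphisms are extensional functions (\<open>undefined\<close> off the carrier), so that equality of HOL
  functions is equality of morphisms. Accordingly the identity of \<open>X\<close> is \<open>\<lambda>x\<in>pts X. x\<close> and the
  composite \<open>X \<rightarrow> Y \<rightarrow> Z\<close> is \<open>compose (pts X) g f\<close>.\<close>
definition pmor :: "'a pspace \<Rightarrow> 'b pspace \<Rightarrow> ('a \<Rightarrow> 'b) set" where
  "pmor X Y = {f \<in> pts X \<rightarrow>\<^sub>E pts Y. f (bpt X) = bpt Y \<and> (\<forall>K\<in>conn X. f ` K \<in> conn Y)}"

definition tensor :: "'a pspace \<Rightarrow> 'b pspace \<Rightarrow> ('a \<times> 'b) pspace" where
  "tensor X Y = \<lparr>pts = pts X \<times> pts Y,
     conn = generated_structure (pts X \<times> pts Y) {K \<times> L | K L. K \<in> conn X \<and> L \<in> conn Y},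
     bpt = (bpt X, bpt Y)\<rparr>"

definition collapse_rel :: "'a set \<Rightarrow> 'a set \<Rightarrow> ('a \<times> 'a) set" where
  "collapse_rel S A = {(p, q). p \<in> S \<and> q \<in> S \<and> (p = q \<or> p \<in> A \<and> q \<in> A)}"

definition collapse_proj :: "'a pspace \<Rightarrow> 'a set \<Rightarrow> 'a \<Rightarrow> 'a set" where
  "collapse_proj X A p = collapse_rel (pts X) A `` {p}"

definition collapse :: "'a pspace \<Rightarrow> 'a set \<Rightarrow> 'a set pspace" where
  "collapse X A = \<lparr>pts = pts X // collapse_rel (pts X) A,
     conn = generated_structure (pts X // collapse_rel (pts X) A)
              {collapse_proj X A ` K | K. K \<in> conn X},
     bpt = collapse_proj X A (bpt X)\<rparr>"

definition wedge_pts :: "'a pspace \<Rightarrow> 'b pspace \<Rightarrow> ('a \<times> 'b) set" where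
  "wedge_pts X Y = (pts X \<times> {bpt Y}) \<union> ({bpt X} \<times> pts Y)"

definition smash :: "'a pspace \<Rightarrow> 'b pspace \<Rightarrow> ('a \<times> 'b) set pspace" where
  "smash X Y = collapse (tensor X Y) (wedge_pts X Y)"

definition smash_pt :: "'a pspace \<Rightarrow> 'b pspace \<Rightarrow> 'a \<Rightarrow> 'b \<Rightarrow> ('a \<times> 'b) set" where
  "smash_pt X Y x y = collapse_proj (tensor X Y) (wedge_pts X Y) (x, y)"

text \<open>The morphism \<open>X \<and> f\<close> for \<open>f : Y \<rightarrow> Z\<close>; the description is well defined by \<open>smash_map_pt\<close>.\<close>
definition smash_map ::
  "'x pspace \<Rightarrow> 'a pspace \<Rightarrow> 'b pspace \<Rightarrow> ('a \<Rightarrow> 'b) \<Rightarrow> ('x \<times> 'a) set \<Rightarrow> ('x \<times> 'b) set" where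
  "smash_map X Y Z f = (\<lambda>c\<in>pts (smash X Y).
     THE d. \<exists>x\<in>pts X. \<exists>y\<in>pts Y. c = smash_pt X Y x y \<and> d = smash_pt X Z x (f y))"

lemma smash_pt_eq_iff:
  assumes "x \<in> pts X" "y \<in> pts Y" "x' \<in> pts X" "y' \<in> pts Y"
  shows "smash_pt X Y x y = smash_pt X Y x' y' \<longleftrightarrow>
    (x, y) = (x', y') \<or> (x, y) \<in> wedge_pts X Y \<and> (x', y') \<in> wedge_pts X Y"
proof -
  have "equiv (pts X \<times> pts Y) (collapse_rel (pts X \<times> pts Y) (wedge_pts X Y))"
    by (rule equivI) (auto simp: collapse_rel_def refl_on_def sym_def trans_def)
  then have "smash_pt X Y x y = smash_pt X Y x' y' \<longleftrightarrow>
      ((x, y), (x', y')) \<in> collapse_rel (pts X \<times> pts Y) (wedge_pts X Y)"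
    using assms by (simp add: smash_pt_def collapse_proj_def tensor_def eq_equiv_class_iff)
  then show ?thesis
    using assms by (simp add: collapse_rel_def)
qed

lemma smash_map_pt:
  assumes "f \<in> pmor Y Z" "x \<in> pts X" "y \<in> pts Y"
  shows "smash_map X Y Z f (smash_pt X Y x y) = smash_pt X Z x (f y)"
proof -
  have f: "f u \<in> pts Z" if "u \<in> pts Y" for u
    using assms(1) that by (auto simp: pmor_def)
  have b: "f (bpt Y) = bpt Z"
    using assms(1) by (simp add: pmor_def)
  have "smash_pt X Y x y \<in> pts (smash X Y)"
    using assms by (auto simp: smash_pt_def smash_def collapse_def collapse_proj_def tensor_def
        intro: quotientI)
  moreover have "smash_pt X Z u (f v) = smash_pt X Z x (f y)"
    if "u \<in> pts X" "v \<in> pts Y" "smash_pt X Y x y = smash_pt X Y u v" for u v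
  proof -
    have "(x, y) = (u, v) \<or> (x, y) \<in> wedge_pts X Y \<and> (u, v) \<in> wedge_pts X Y"
      using that assms by (simp add: smash_pt_eq_iff)
    moreover have "(p, f q) \<in> wedge_pts X Z" if "(p, q) \<in> wedge_pts X Y" for p q
      using that f b by (auto simp: wedge_pts_def)
    ultimately show ?thesis
      using that assms f by (auto simp: smash_pt_eq_iff)
  qed
  ultimately have "(THE d. \<exists>u\<in>pts X. \<exists>v\<in>pts Y. smash_pt X Y x y = smash_pt X Y u v \<and>
      d = smash_pt X Z u (f v)) = smash_pt X Z x (f y)"
    using assms(2,3) by (intro the_equality) blast+
  with \<open>smash_pt X Y x y \<in> pts (smash X Y)\<close> show ?thesis
    by (simp add: smash_map_def)
qed

definition phom :: "'a pspace \<Rightarrow> 'b pspace \<Rightarrow> ('a \<Rightarrow> 'b) pspace" where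
  "phom X Y = \<lparr>pts = pmor X Y,
     conn = {M. M \<subseteq> pmor X Y \<and> (\<forall>K\<in>conn X. (\<Union>f\<in>M. f ` K) \<in> conn Y)},
     bpt = (\<lambda>x\<in>pts X. bpt Y)\<rparr>"

definition phom_map ::
  "'x pspace \<Rightarrow> 'a pspace \<Rightarrow> 'b pspace \<Rightarrow> ('a \<Rightarrow> 'b) \<Rightarrow> ('x \<Rightarrow> 'a) \<Rightarrow> ('x \<Rightarrow> 'b)" where
  "phom_map X Y Z g = (\<lambda>f\<in>pmor X Y. compose (pts X) g f)"

text \<open>The transposition \<open>Hom(X \<and> Y, Z) \<rightarrow> Hom(Y, pCnct(X, Z))\<close> of the adjunction. The functors change
  the carrier type, so the natural family must be a polymorphic constant: a bound variable
  would have a single type instance and could not express naturality across carrier types.\<close>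
definition smash_transpose ::
  "'x pspace \<Rightarrow> 'y pspace \<Rightarrow> (('x \<times> 'y) set \<Rightarrow> 'z) \<Rightarrow> 'y \<Rightarrow> 'x \<Rightarrow> 'z" where
  "smash_transpose X Y f = (\<lambda>y\<in>pts Y. \<lambda>x\<in>pts X. f (smash_pt X Y x y))"

end

theory Submission
  imports Defs
begin

text \<open>A map out of a generated structure is connecting as soon as it sends generators to connected
  sets. Applied twice, this says that a map \<open>F\<close> out of \<open>X \<and> Y\<close> is connecting iff the sets
  \<open>F (K \<times> L)\<close> are connected for connected \<open>K\<close>, \<open>L\<close>. The latter set is the union of the \<open>f\<^sub>y (K)\<close>,
  \<open>y \<in> L\<close>, where \<open>f\<^sub>y\<close> is the transpose of \<open>F\<close> at \<open>y\<close>, so the condition is precisely that the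
  transpose is connecting into \<open>pCnct(X, Z)\<close>. Likewise, \<open>F\<close> is constant on the wedge iff the
  transpose is based and takes based maps as values.\<close>

section \<open>Connectivity structures and maps out of generated ones\<close>

lemma connectivity_structureD:
  assumes "connectivity_structure S \<K>"
  shows "K \<in> \<K> \<Longrightarrow> K \<subseteq> S"
    and "{} \<in> \<K>"
    and "\<I> \<subseteq> \<K> \<Longrightarrow> x \<in> \<Inter>\<I> \<Longrightarrow> \<Union>\<I> \<in> \<K>"
  using assms unfolding connectivity_structure_def by blast+

text \<open>Direct images commute with unions, and a common point \<open>x\<close> of a family gives
  the common point \<open>F x\<close> of its images. So the sets that \<open>F\<close> sends into
  \<L> inherit the closure condition.\<close>

lemma connectivity_structure_preimage:
  assumes "connectivity_structure T \<L>"
  shows "connectivity_structure S {K. K \<subseteq> S \<and> F ` K \<in> \<L>}"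
  unfolding connectivity_structure_def
proof (intro conjI allI impI)
  show "{} \<in> {K. K \<subseteq> S \<and> F ` K \<in> \<L>}"
    using connectivity_structureD(2)[OF assms] by simp
next
  fix \<I> assume "\<I> \<subseteq> {K. K \<subseteq> S \<and> F ` K \<in> \<L>} \<and> \<Inter>\<I> \<noteq> {}"
  then obtain x where \<I>: "\<I> \<subseteq> {K. K \<subseteq> S \<and> F ` K \<in> \<L>}" and x: "x \<in> \<Inter>\<I>"
    by blast
  have "\<Union>((`) F ` \<I>) \<in> \<L>"
    by (rule connectivity_structureD(3)[OF assms, where x = "F x"]) (use \<I> x in auto)
  then have "F ` \<Union>\<I> \<in> \<L>"
    by (simp add: image_Union)
  with \<I> show "\<Union>\<I> \<in> {K. K \<subseteq> S \<and> F ` K \<in> \<L>}"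
    by blast
qed blast

text \<open>Minimality of the generated structure, applied to the structure of all sets with
  connected image. It plays the role of an induction over the sets generated.\<close>

lemma generated_structure_image:
  assumes "connectivity_structure T \<L>" "\<A> \<subseteq> Pow S" "\<And>A. A \<in> \<A> \<Longrightarrow> F ` A \<in> \<L>"
    and "K \<in> generated_structure S \<A>"
  shows "F ` K \<in> \<L>"
proof -
  have "generated_structure S \<A> \<subseteq> {K. K \<subseteq> S \<and> F ` K \<in> \<L>}"
    using assms(2,3)
    by (intro generated_structure_least(3) connectivity_structure_preimage[OF assms(1)]) auto
  with assms(4) show ?thesis by blast
qed

section \<open>Objects and morphisms of \<open>pCnct\<close>\<close>

lemma pCnctD:
  assumes "X \<in> pCnct"
  shows "connectivity_structure (pts X) (conn X)"
    and "bpt X \<in> pts X"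
    and "x \<in> pts X \<Longrightarrow> {x} \<in> conn X"
    and "K \<in> conn X \<Longrightarrow> K \<subseteq> pts X"
    and "{} \<in> conn X"
  using assms unfolding pCnct_def integral_structure_def connectivity_structure_def by auto

lemma pCnctI:
  assumes "connectivity_structure (pts X) (conn X)" "bpt X \<in> pts X"
    and "\<And>x. x \<in> pts X \<Longrightarrow> {x} \<in> conn X"
  shows "X \<in> pCnct"
  using assms unfolding pCnct_def integral_structure_def by auto

lemma pmorD:
  assumes "f \<in> pmor X Y"
  shows "f \<in> extensional (pts X)"
    and "x \<in> pts X \<Longrightarrow> f x \<in> pts Y"
    and "f (bpt X) = bpt Y"
    and "K \<in> conn X \<Longrightarrow> f ` K \<in> conn Y"
  using assms unfolding pmor_def by (auto simp: PiE_def)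

lemma pmorI:
  assumes "f \<in> extensional (pts X)" "\<And>x. x \<in> pts X \<Longrightarrow> f x \<in> pts Y" "f (bpt X) = bpt Y"
    and "\<And>K. K \<in> conn X \<Longrightarrow> f ` K \<in> conn Y"
  shows "f \<in> pmor X Y"
  using assms unfolding pmor_def by (auto simp: PiE_def)

lemma pmor_compose:
  assumes "X \<in> pCnct" "f \<in> pmor X Y" "g \<in> pmor Y Z"
  shows "compose (pts X) g f \<in> pmor X Z"
proof (rule pmorI)
  fix K assume K: "K \<in> conn X"
  \<comment> \<open>\<open>compose\<close> is \<open>undefined\<close> off \<open>pts X\<close>, so
    the equality rests on \<open>K\<close> lying inside the carrier.\<close>
  then have "compose (pts X) g f ` K = g ` f ` K"
    using pCnctD(4)[OF assms(1) K] by (force simp: compose_def)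
  then show "compose (pts X) g f ` K \<in> conn Z"
    using K assms by (simp add: pmorD(4))
qed (use assms in \<open>auto simp: compose_def pmorD pCnctD(2)\<close>)

section \<open>The smash product as an object, and maps out of it\<close>

lemma smash_pt_in: "x \<in> pts X \<Longrightarrow> y \<in> pts Y \<Longrightarrow> smash_pt X Y x y \<in> pts (smash X Y)"
  by (auto simp: smash_pt_def smash_def collapse_def collapse_proj_def tensor_def intro: quotientI)

lemma smash_cases:
  assumes "c \<in> pts (smash X Y)"
  obtains x y where "x \<in> pts X" "y \<in> pts Y" "c = smash_pt X Y x y"
  using assms
  by (auto simp: smash_pt_def smash_def collapse_def collapse_proj_def tensor_def elim!: quotientE)

lemma bpt_smash: "bpt (smash X Y) = smash_pt X Y (bpt X) (bpt Y)"
  by (simp add: smash_def collapse_def smash_pt_def tensor_def)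

text \<open>Both axes lie in the collapsed wedge. The first equation will make each value of a
  transpose a based map, the second will make the transpose itself based.\<close>

lemma smash_pt_bpt:
  assumes "X \<in> pCnct" "Y \<in> pCnct"
  shows "y \<in> pts Y \<Longrightarrow> smash_pt X Y (bpt X) y = bpt (smash X Y)"
    and "x \<in> pts X \<Longrightarrow> smash_pt X Y x (bpt Y) = bpt (smash X Y)"
  using assms by (auto simp: bpt_smash smash_pt_eq_iff pCnctD(2) wedge_pts_def)

text \<open>Every point of the quotient has a representative pair, so equations between morphisms
  out of \<open>smash X Y\<close> need checking only on classes of pairs.\<close>

lemma smash_extensional_eqI:
  assumes "f \<in> extensional (pts (smash X Y))" "g \<in> extensional (pts (smash X Y))"
    and "\<And>x y. x \<in> pts X \<Longrightarrow> y \<in> pts Y \<Longrightarrow> f (smash_pt X Y x y) = g (smash_pt X Y x y)"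
  shows "f = g"
  by (rule extensionalityI[OF assms(1,2)]) (auto elim: smash_cases simp: assms(3))

context
  fixes X :: "'x pspace" and Y :: "'y pspace"
  assumes X: "X \<in> pCnct" and Y: "Y \<in> pCnct"
begin

lemma rectangles_subset:
  "{K \<times> L | K L. K \<in> conn X \<and> L \<in> conn Y} \<subseteq> Pow (pts X \<times> pts Y)"
  using pCnctD(4)[OF X] pCnctD(4)[OF Y] by blast

lemma conn_tensor_subset: "K \<in> conn (tensor X Y) \<Longrightarrow> K \<subseteq> pts X \<times> pts Y"
  using connectivity_structureD(1)[OF generated_structure_least(1)[OF rectangles_subset]]
  by (simp add: tensor_def)

lemma smash_generators_subset:
  "{collapse_proj (tensor X Y) (wedge_pts X Y) ` K | K. K \<in> conn (tensor X Y)}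
    \<subseteq> Pow (pts (smash X Y))"
  using conn_tensor_subset smash_pt_in[of _ X _ Y] unfolding smash_pt_def by blast

lemma conn_smash:
  "conn (smash X Y) = generated_structure (pts (smash X Y))
     {collapse_proj (tensor X Y) (wedge_pts X Y) ` K | K. K \<in> conn (tensor X Y)}"
  by (simp add: smash_def collapse_def)

text \<open>A rectangle is a generator of the tensor structure, and its image is then a generator of
  the quotient structure. Together with \<open>smash_morI\<close> this replaces any explicit
  description of the connected sets of \<open>smash X Y\<close>.\<close>

lemma smash_rectangle_conn:
  assumes "K \<in> conn X" "L \<in> conn Y"
  shows "(\<lambda>(x, y). smash_pt X Y x y) ` (K \<times> L) \<in> conn (smash X Y)"
proof -
  have "K \<times> L \<in> conn (tensor X Y)"
    using assms generated_structure_least(2)[OF rectangles_subset] by (auto simp: tensor_def)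
  then have "collapse_proj (tensor X Y) (wedge_pts X Y) ` (K \<times> L) \<in> conn (smash X Y)"
    unfolding conn_smash using generated_structure_least(2)[OF smash_generators_subset] by blast
  then show ?thesis
    by (simp add: smash_pt_def case_prod_unfold)
qed

lemma smash_in_pCnct: "smash X Y \<in> pCnct"
proof (rule pCnctI)
  show "connectivity_structure (pts (smash X Y)) (conn (smash X Y))"
    unfolding conn_smash by (rule generated_structure_least(1)[OF smash_generators_subset])
  show "bpt (smash X Y) \<in> pts (smash X Y)"
    by (simp add: bpt_smash smash_pt_in X Y pCnctD(2))
  fix c assume "c \<in> pts (smash X Y)"
  then obtain x y where "x \<in> pts X" "y \<in> pts Y" "c = smash_pt X Y x y"
    by (rule smash_cases)
  \<comment> \<open>Integrality comes from the factors: the singleton of a class is the image of the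
    rectangle \<open>{x} \<times> {y}\<close>.\<close>
  then show "{c} \<in> conn (smash X Y)"
    using smash_rectangle_conn[of "{x}" "{y}"] by (simp add: pCnctD(3) X Y)
qed

text \<open>The structure is generated in two stages, so \<open>generated_structure_image\<close> is
  used twice: first to pass from the quotient to images of tensor-connected sets, then from those to
  rectangles.\<close>

lemma smash_morI:
  assumes Z: "Z \<in> pCnct" and F: "F \<in> extensional (pts (smash X Y))"
    and pts: "\<And>x y. x \<in> pts X \<Longrightarrow> y \<in> pts Y \<Longrightarrow> F (smash_pt X Y x y) \<in> pts Z"
    and bpt: "F (smash_pt X Y (bpt X) (bpt Y)) = bpt Z"
    and conn: "\<And>K L. K \<in> conn X \<Longrightarrow> L \<in> conn Y \<Longrightarrow>
      (\<lambda>(x, y). F (smash_pt X Y x y)) ` (K \<times> L) \<in> conn Z"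
  shows "F \<in> pmor (smash X Y) Z"
proof (rule pmorI[OF F])
  fix K assume "K \<in> conn (smash X Y)"
  then show "F ` K \<in> conn Z"
    unfolding conn_smash
  proof (rule generated_structure_image[OF pCnctD(1)[OF Z] smash_generators_subset, rotated])
    fix A assume "A \<in> {collapse_proj (tensor X Y) (wedge_pts X Y) ` K | K. K \<in> conn (tensor X Y)}"
    then obtain B where A: "A = collapse_proj (tensor X Y) (wedge_pts X Y) ` B"
      and B: "B \<in> generated_structure (pts X \<times> pts Y) {K \<times> L | K L. K \<in> conn X \<and> L \<in> conn Y}"
      by (auto simp: tensor_def)
    have "(\<lambda>(x, y). F (smash_pt X Y x y)) ` B \<in> conn Z"
      using conn
      by (intro generated_structure_image[OF pCnctD(1)[OF Z] rectangles_subset _ B]) blast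
    then show "F ` A \<in> conn Z"
      by (simp add: A image_image smash_pt_def case_prod_unfold)
  qed
qed (use pts bpt in \<open>auto simp: bpt_smash elim: smash_cases\<close>)

end

section \<open>Functoriality of the smash product with \<open>X\<close>\<close>

lemma smash_map_in_pmor:
  assumes X: "X \<in> pCnct" and Y: "Y \<in> pCnct" and Z: "Z \<in> pCnct" and f: "f \<in> pmor Y Z"
  shows "smash_map X Y Z f \<in> pmor (smash X Y) (smash X Z)"
proof (rule smash_morI[OF X Y smash_in_pCnct[OF X Z]])
  fix K L assume K: "K \<in> conn X" and L: "L \<in> conn Y"
  have "(\<lambda>(x, y). smash_map X Y Z f (smash_pt X Y x y)) ` (K \<times> L) =
      (\<lambda>(x, y). smash_pt X Z x (f y)) ` (K \<times> L)"
    using pCnctD(4)[OF X K] pCnctD(4)[OF Y L]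
    by (intro image_cong) (auto simp: smash_map_pt[OF f] subset_iff)
  also have "\<dots> = (\<lambda>(x, z). smash_pt X Z x z) ` (K \<times> f ` L)"
    by force
  also have "\<dots> \<in> conn (smash X Z)"
    by (rule smash_rectangle_conn[OF X Z K pmorD(4)[OF f L]])
  finally show "(\<lambda>(x, y). smash_map X Y Z f (smash_pt X Y x y)) ` (K \<times> L) \<in> conn (smash X Z)" .
qed (use assms in \<open>auto simp: smash_map_pt smash_pt_in pmorD bpt_smash pCnctD(2)\<close>,
     simp add: smash_map_def)

lemma id_in_pmor:
  assumes "Y \<in> pCnct"
  shows "(\<lambda>y\<in>pts Y. y) \<in> pmor Y Y"
proof (rule pmorI)
  fix K assume "K \<in> conn Y"
  moreover from this have "(\<lambda>y\<in>pts Y. y) ` K = K"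
    using pCnctD(4)[OF assms] by force
  ultimately show "(\<lambda>y\<in>pts Y. y) ` K \<in> conn Y" by simp
qed (auto simp: pCnctD(2)[OF assms])

lemma smash_map_id:
  assumes "Y \<in> pCnct"
  shows "smash_map X Y Y (\<lambda>y\<in>pts Y. y) = (\<lambda>c\<in>pts (smash X Y). c)"
proof (rule smash_extensional_eqI)
  fix x y assume "x \<in> pts X" "y \<in> pts Y"
  then show "smash_map X Y Y (\<lambda>y\<in>pts Y. y) (smash_pt X Y x y) =
      (\<lambda>c\<in>pts (smash X Y). c) (smash_pt X Y x y)"
    by (simp add: smash_map_pt[OF id_in_pmor[OF assms]] smash_pt_in)
qed (simp_all add: smash_map_def)

lemma smash_map_compose:
  assumes "Y \<in> pCnct" "f \<in> pmor Y Z" "g \<in> pmor Z W"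
  shows "smash_map X Y W (compose (pts Y) g f) =
    compose (pts (smash X Y)) (smash_map X Z W g) (smash_map X Y Z f)"
proof (rule smash_extensional_eqI)
  fix x y assume "x \<in> pts X" "y \<in> pts Y"
  then show "smash_map X Y W (compose (pts Y) g f) (smash_pt X Y x y) =
      compose (pts (smash X Y)) (smash_map X Z W g) (smash_map X Y Z f) (smash_pt X Y x y)"
    using assms by (simp add: smash_map_pt pmor_compose smash_pt_in compose_eq pmorD(2))
qed (simp_all add: smash_map_def)

section \<open>The internal hom and its functoriality\<close>

lemma phom_simps:
  "pts (phom X Y) = pmor X Y"
  "M \<in> conn (phom X Y) \<longleftrightarrow> M \<subseteq> pmor X Y \<and> (\<forall>K\<in>conn X. (\<Union>f\<in>M. f ` K) \<in> conn Y)"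
  "bpt (phom X Y) = (\<lambda>x\<in>pts X. bpt Y)"
  by (simp_all add: phom_def)

lemma const_in_pmor:
  assumes X: "X \<in> pCnct" and Y: "Y \<in> pCnct"
  shows "(\<lambda>x\<in>pts X. bpt Y) \<in> pmor X Y"
proof (rule pmorI)
  fix K assume "K \<in> conn X"
  \<comment> \<open>The empty set is connected too, and its image is not the singleton of the
    base-point.\<close>
  then have "(\<lambda>x\<in>pts X. bpt Y) ` K = (if K = {} then {} else {bpt Y})"
    using pCnctD(4)[OF X] by force
  then show "(\<lambda>x\<in>pts X. bpt Y) ` K \<in> conn Y"
    by (simp add: pCnctD[OF Y])
qed (auto simp: pCnctD(2) X Y)

lemma phom_in_pCnct:
  assumes X: "X \<in> pCnct" and Y: "Y \<in> pCnct"
  shows "phom X Y \<in> pCnct"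
proof (rule pCnctI)
  show "connectivity_structure (pts (phom X Y)) (conn (phom X Y))"
    unfolding connectivity_structure_def
  proof (intro conjI allI impI)
    fix \<I> assume "\<I> \<subseteq> conn (phom X Y) \<and> \<Inter>\<I> \<noteq> {}"
    then obtain f where \<I>: "\<And>M. M \<in> \<I> \<Longrightarrow> M \<in> conn (phom X Y)" and f: "\<And>M. M \<in> \<I> \<Longrightarrow> f \<in> M"
      by blast
    have "(\<Union>f\<in>\<Union>\<I>. f ` K) \<in> conn Y" if K: "K \<in> conn X" for K
    proof (cases "K = {}")
      case True
      then show ?thesis by (simp add: pCnctD(5)[OF Y])
    next
      case False
      then obtain x where x: "x \<in> K" by blast
      have "\<Union>((\<lambda>M. \<Union>f\<in>M. f ` K) ` \<I>) \<in> conn Y"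
      proof (rule connectivity_structureD(3)[OF pCnctD(1)[OF Y], where x = "f x"])
        show "(\<lambda>M. \<Union>f\<in>M. f ` K) ` \<I> \<subseteq> conn Y"
          using \<I> K by (auto simp: phom_simps)
        show "f x \<in> \<Inter>((\<lambda>M. \<Union>f\<in>M. f ` K) ` \<I>)"
          using f x by blast
      qed
      then show ?thesis by (simp add: UN_UN_flatten)
    qed
    then show "\<Union>\<I> \<in> conn (phom X Y)"
      using \<I> by (auto simp: phom_simps)
  qed (auto simp: phom_simps pCnctD(5)[OF Y])
  show "bpt (phom X Y) \<in> pts (phom X Y)"
    by (simp add: phom_simps const_in_pmor X Y)
  show "{f} \<in> conn (phom X Y)" if "f \<in> pts (phom X Y)" for f
    using that by (auto simp: phom_simps pmorD(4))
qed

lemma phom_map_in_pmor: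
  assumes X: "X \<in> pCnct" and Y: "Y \<in> pCnct" and g: "g \<in> pmor Y Z"
  shows "phom_map X Y Z g \<in> pmor (phom X Y) (phom X Z)"
proof (rule pmorI)
  show "phom_map X Y Z g (bpt (phom X Y)) = bpt (phom X Z)"
    using const_in_pmor[OF X Y] pmorD(3)[OF g]
    by (auto simp: phom_map_def phom_simps compose_def fun_eq_iff)
next
  fix M assume M: "M \<in> conn (phom X Y)"
  then have sub: "M \<subseteq> pmor X Y"
    by (simp add: phom_simps)
  have "(\<Union>h\<in>phom_map X Y Z g ` M. h ` K) \<in> conn Z" if K: "K \<in> conn X" for K
  proof -
    have "phom_map X Y Z g f ` K = g ` f ` K" if "f \<in> M" for f
      using that sub pCnctD(4)[OF X K] by (force simp: phom_map_def compose_def)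
    \<comment> \<open>Postcomposition moves \<open>g\<close> outside the union, so that
      \<open>g\<close> being connecting is all that remains to apply.\<close>
    then have "(\<Union>h\<in>phom_map X Y Z g ` M. h ` K) = g ` (\<Union>f\<in>M. f ` K)"
      by auto
    moreover have "(\<Union>f\<in>M. f ` K) \<in> conn Y"
      using M K by (simp add: phom_simps)
    ultimately show ?thesis
      using pmorD(4)[OF g] by simp
  qed
  then show "phom_map X Y Z g ` M \<in> conn (phom X Z)"
    using sub pmor_compose[OF X _ g] by (auto simp: phom_simps phom_map_def)
qed (use pmor_compose[OF X _ g] in \<open>auto simp: phom_map_def phom_simps\<close>)

lemma phom_map_id: "phom_map X Y Y (\<lambda>y\<in>pts Y. y) = (\<lambda>f\<in>pts (phom X Y). f)"
  unfolding phom_map_def phom_simps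
proof (rule restrict_ext)
  fix f assume f: "f \<in> pmor X Y"
  show "compose (pts X) (\<lambda>y\<in>pts Y. y) f = f"
    by (rule extensionalityI[OF compose_extensional pmorD(1)[OF f]])
      (simp add: compose_eq pmorD(2)[OF f])
qed

lemma phom_map_compose:
  assumes X: "X \<in> pCnct" and f: "f \<in> pmor Y Z"
  shows "phom_map X Y W (compose (pts Y) g f) =
    compose (pts (phom X Y)) (phom_map X Z W g) (phom_map X Y Z f)"
  \<comment> \<open>\<open>phom_map X Z W g\<close> is \<open>undefined\<close> off
    \<open>pmor X Z\<close>, so composites with \<open>f\<close> must be known to be
    morphisms.\<close>
  using pmor_compose[OF X _ f]
  by (auto simp: phom_map_def phom_simps compose_def fun_eq_iff restrict_def pmorD(2))

section \<open>Transposition and its bijectivity\<close>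

lemma smash_transpose_apply:
  "x \<in> pts X \<Longrightarrow> y \<in> pts Y \<Longrightarrow> smash_transpose X Y f y x = f (smash_pt X Y x y)"
  by (simp add: smash_transpose_def)

lemma smash_transpose_in_pmor:
  assumes X: "X \<in> pCnct" and Y: "Y \<in> pCnct" and f: "f \<in> pmor (smash X Y) Z"
  shows "smash_transpose X Y f \<in> pmor Y (phom X Z)"
proof -
  \<comment> \<open>This serves twice: for \<open>L\<close> a singleton it shows that each value of
    the transpose is connecting, and for general \<open>L\<close> that the transpose itself
    is.\<close>
  have union: "(\<Union>h\<in>smash_transpose X Y f ` L. h ` K) \<in> conn Z"
    if K: "K \<in> conn X" and L: "L \<in> conn Y" for K L
  proof -
    have "(\<Union>h\<in>smash_transpose X Y f ` L. h ` K) = f ` (\<lambda>(x, y). smash_pt X Y x y) ` (K \<times> L)"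
      using pCnctD(4)[OF X K] pCnctD(4)[OF Y L]
      by (force simp: smash_transpose_apply subset_iff)
    then show ?thesis
      using pmorD(4)[OF f smash_rectangle_conn[OF X Y K L]] by simp
  qed
  have mor: "smash_transpose X Y f y \<in> pmor X Z" if y: "y \<in> pts Y" for y
  proof (rule pmorI)
    show "smash_transpose X Y f y \<in> extensional (pts X)"
      using y by (simp add: smash_transpose_def)
    show "smash_transpose X Y f y (bpt X) = bpt Z"
      using y by (simp add: smash_transpose_apply pCnctD(2) X Y smash_pt_bpt pmorD(3)[OF f])
    show "smash_transpose X Y f y x \<in> pts Z" if "x \<in> pts X" for x
      using that y by (simp add: smash_transpose_apply smash_pt_in pmorD(2)[OF f])
    show "smash_transpose X Y f y ` K \<in> conn Z" if "K \<in> conn X" for K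
      using union[OF that pCnctD(3)[OF Y y]] by simp
  qed
  show ?thesis
  proof (rule pmorI)
    show "smash_transpose X Y f (bpt Y) = bpt (phom X Z)"
      unfolding phom_simps
      by (rule extensionalityI[OF pmorD(1)[OF mor] restrict_extensional])
        (simp_all add: smash_transpose_apply pCnctD(2) X Y smash_pt_bpt pmorD(3)[OF f])
    show "smash_transpose X Y f ` L \<in> conn (phom X Z)" if L: "L \<in> conn Y" for L
      using union[OF _ L] mor pCnctD(4)[OF Y L] by (auto simp: phom_simps)
  qed (auto simp: phom_simps mor, simp add: smash_transpose_def)
qed

text \<open>The universal property of the quotient at the level of sets: two pairs with the same
  class are equal or both in the wedge, so the description defining \<open>F\<close> has a unique
  solution on every class.\<close>

lemma smash_lift_exists:
  assumes const: "\<And>x y x' y'. (x, y) \<in> wedge_pts X Y \<Longrightarrow> (x', y') \<in> wedge_pts X Y \<Longrightarrow> u x y = u x' y'"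
  obtains F where "F \<in> extensional (pts (smash X Y))"
    and "\<And>x y. x \<in> pts X \<Longrightarrow> y \<in> pts Y \<Longrightarrow> F (smash_pt X Y x y) = u x y"
proof
  define F where "F = (\<lambda>c\<in>pts (smash X Y).
    THE z. \<exists>x\<in>pts X. \<exists>y\<in>pts Y. c = smash_pt X Y x y \<and> z = u x y)"
  show "F \<in> extensional (pts (smash X Y))"
    by (simp add: F_def)
  fix x y assume xy: "x \<in> pts X" "y \<in> pts Y"
  have "u x' y' = u x y"
    if "x' \<in> pts X" "y' \<in> pts Y" "smash_pt X Y x y = smash_pt X Y x' y'" for x' y'
    using that xy const[of x' y' x y] by (auto simp: smash_pt_eq_iff)
  then have "(THE z. \<exists>x'\<in>pts X. \<exists>y'\<in>pts Y. smash_pt X Y x y = smash_pt X Y x' y' \<and> z = u x' y') = u x y"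
    using xy by (intro the_equality) blast+
  then show "F (smash_pt X Y x y) = u x y"
    using xy by (simp add: F_def smash_pt_in)
qed

lemma smash_transpose_surj:
  assumes X: "X \<in> pCnct" and Y: "Y \<in> pCnct" and Z: "Z \<in> pCnct" and g: "g \<in> pmor Y (phom X Z)"
  obtains F where "F \<in> pmor (smash X Y) Z" "smash_transpose X Y F = g"
proof -
  have gy: "g y \<in> pmor X Z" if "y \<in> pts Y" for y
    using pmorD(2)[OF g that] by (simp add: phom_simps)
  \<comment> \<open>On the axis \<open>x = bpt X\<close> this holds because \<open>g y\<close> is
    based, on the axis \<open>y = bpt Y\<close> because \<open>g\<close> is based and the base-point
    of \<open>phom X Z\<close> is the constant map.\<close>
  have "g y x = bpt Z" if "(x, y) \<in> wedge_pts X Y" for x y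
    using that pmorD(3)[OF g] pmorD(3)[OF gy] by (auto simp: wedge_pts_def phom_simps)
  then obtain F where ext: "F \<in> extensional (pts (smash X Y))"
    and F: "\<And>x y. x \<in> pts X \<Longrightarrow> y \<in> pts Y \<Longrightarrow> F (smash_pt X Y x y) = g y x"
    using smash_lift_exists[of X Y "\<lambda>x y. g y x"] by metis
  show thesis
  proof
    show "F \<in> pmor (smash X Y) Z"
    proof (rule smash_morI[OF X Y Z ext])
      show "F (smash_pt X Y x y) \<in> pts Z" if "x \<in> pts X" "y \<in> pts Y" for x y
        using that by (simp add: F pmorD(2)[OF gy])
      show "F (smash_pt X Y (bpt X) (bpt Y)) = bpt Z"
        by (simp add: F pCnctD(2) X Y pmorD(3)[OF gy])
      fix K L assume K: "K \<in> conn X" and L: "L \<in> conn Y"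
      have "(\<lambda>(x, y). F (smash_pt X Y x y)) ` (K \<times> L) = (\<Union>h\<in>g ` L. h ` K)"
        using pCnctD(4)[OF X K] pCnctD(4)[OF Y L] by (force simp: F subset_iff)
      moreover have "(\<Union>h\<in>g ` L. h ` K) \<in> conn Z"
        using pmorD(4)[OF g L] K unfolding phom_simps by blast
      ultimately show "(\<lambda>(x, y). F (smash_pt X Y x y)) ` (K \<times> L) \<in> conn Z"
        by simp
    qed
    show "smash_transpose X Y F = g"
    proof (rule extensionalityI[OF _ pmorD(1)[OF g]])
      fix y assume y: "y \<in> pts Y"
      show "smash_transpose X Y F y = g y"
        by (rule extensionalityI[OF _ pmorD(1)[OF gy[OF y]]])
          (use y in \<open>simp_all add: smash_transpose_def F\<close>)
    qed (simp add: smash_transpose_def)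
  qed
qed

lemma smash_transpose_bij_betw:
  assumes X: "X \<in> pCnct" and Y: "Y \<in> pCnct" and Z: "Z \<in> pCnct"
  shows "bij_betw (smash_transpose X Y) (pmor (smash X Y) Z) (pmor Y (phom X Z))"
  unfolding bij_betw_def
proof
  show "inj_on (smash_transpose X Y) (pmor (smash X Y) Z)"
  proof (rule inj_onI)
    fix f g assume f: "f \<in> pmor (smash X Y) Z" and g: "g \<in> pmor (smash X Y) Z"
      and eq: "smash_transpose X Y f = smash_transpose X Y g"
    show "f = g"
    proof (rule smash_extensional_eqI[OF pmorD(1)[OF f] pmorD(1)[OF g]])
      fix x y assume "x \<in> pts X" "y \<in> pts Y"
      then show "f (smash_pt X Y x y) = g (smash_pt X Y x y)"
        using eq by (metis smash_transpose_apply)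
    qed
  qed
  show "smash_transpose X Y ` pmor (smash X Y) Z = pmor Y (phom X Z)"
    using smash_transpose_in_pmor[OF X Y] smash_transpose_surj[OF X Y Z] by blast
qed

section \<open>Naturality and the adjunction\<close>

lemma smash_transpose_natural:
  assumes X: "X \<in> pCnct" and Y: "Y \<in> pCnct" and h: "h \<in> pmor Y' Y"
    and f: "f \<in> pmor (smash X Y) Z"
  shows "smash_transpose X Y'
      (compose (pts (smash X Y')) k (compose (pts (smash X Y')) f (smash_map X Y' Y h))) =
    compose (pts Y') (phom_map X Z Z' k) (compose (pts Y') (smash_transpose X Y f) h)"
    (is "?L = ?R")
proof (rule extensionalityI[where A = "pts Y'"])
  fix y assume y: "y \<in> pts Y'"
  then have hy: "h y \<in> pts Y"
    by (rule pmorD(2)[OF h])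
  \<comment> \<open>Needed to unfold \<open>phom_map X Z Z' k\<close>, which is composition with
    \<open>k\<close> on \<open>pmor X Z\<close> only.\<close>
  then have mor: "smash_transpose X Y f (h y) \<in> pmor X Z"
    using pmorD(2)[OF smash_transpose_in_pmor[OF X Y f]] by (simp add: phom_simps)
  show "?L y = ?R y"
  proof (rule extensionalityI[where A = "pts X"])
    fix x assume x: "x \<in> pts X"
    \<comment> \<open>Both sides evaluate to \<open>k (f (smash_pt X Y x (h y)))\<close>.\<close>
    then show "?L y x = ?R y x"
      using y hy mor
      by (simp add: smash_transpose_apply compose_eq phom_map_def smash_pt_in smash_map_pt[OF h])
  qed (use y mor in \<open>simp_all add: smash_transpose_def compose_eq phom_map_def\<close>)
qed (simp_all add: smash_transpose_def)

theorem theorem15: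
  fixes X :: "'x pspace"
  assumes "X \<in> pCnct"
  shows
    "(\<forall>Y\<in>(pCnct :: 'a pspace set). smash X Y \<in> pCnct) \<and>
     (\<forall>Y\<in>(pCnct :: 'a pspace set). \<forall>Z\<in>(pCnct :: 'b pspace set). \<forall>f\<in>pmor Y Z.
        smash_map X Y Z f \<in> pmor (smash X Y) (smash X Z)) \<and>
     (\<forall>Y\<in>(pCnct :: 'a pspace set).
        smash_map X Y Y (\<lambda>y\<in>pts Y. y) = (\<lambda>c\<in>pts (smash X Y). c)) \<and>
     (\<forall>Y\<in>(pCnct :: 'a pspace set). \<forall>Z\<in>(pCnct :: 'b pspace set). \<forall>W\<in>(pCnct :: 'c pspace set).
        \<forall>f\<in>pmor Y Z. \<forall>g\<in>pmor Z W.
        smash_map X Y W (compose (pts Y) g f) =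
          compose (pts (smash X Y)) (smash_map X Z W g) (smash_map X Y Z f)) \<and>
     (\<forall>Y\<in>(pCnct :: 'a pspace set). phom X Y \<in> pCnct) \<and>
     (\<forall>Y\<in>(pCnct :: 'a pspace set). \<forall>Z\<in>(pCnct :: 'b pspace set). \<forall>g\<in>pmor Y Z.
        phom_map X Y Z g \<in> pmor (phom X Y) (phom X Z)) \<and>
     (\<forall>Y\<in>(pCnct :: 'a pspace set).
        phom_map X Y Y (\<lambda>y\<in>pts Y. y) = (\<lambda>f\<in>pts (phom X Y). f)) \<and>
     (\<forall>Y\<in>(pCnct :: 'a pspace set). \<forall>Z\<in>(pCnct :: 'b pspace set). \<forall>W\<in>(pCnct :: 'c pspace set).
        \<forall>f\<in>pmor Y Z. \<forall>g\<in>pmor Z W.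
        phom_map X Y W (compose (pts Y) g f) =
          compose (pts (phom X Y)) (phom_map X Z W g) (phom_map X Y Z f)) \<and>
     (\<forall>Y\<in>(pCnct :: 'y pspace set). \<forall>Z\<in>(pCnct :: 'z pspace set).
        bij_betw (smash_transpose X Y) (pmor (smash X Y) Z) (pmor Y (phom X Z))) \<and>
     (\<forall>Y\<in>(pCnct :: 'y pspace set). \<forall>Y'\<in>(pCnct :: 'v pspace set).
      \<forall>Z\<in>(pCnct :: 'z pspace set). \<forall>Z'\<in>(pCnct :: 'w pspace set).
        \<forall>h\<in>pmor Y' Y. \<forall>k\<in>pmor Z Z'. \<forall>f\<in>pmor (smash X Y) Z.
        smash_transpose X Y'
            (compose (pts (smash X Y')) k (compose (pts (smash X Y')) f (smash_map X Y' Y h))) =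
          compose (pts Y') (phom_map X Z Z' k) (compose (pts Y') (smash_transpose X Y f) h))"
  \<comment> \<open>The lemmas are polymorphic in the carrier types, so each conjunct is an instance
    of one of them at its own types.\<close>
  using assms
  by (intro conjI ballI)
    (rule smash_in_pCnct smash_map_in_pmor smash_map_id smash_map_compose phom_in_pCnct
      phom_map_in_pmor phom_map_id phom_map_compose smash_transpose_bij_betw
      smash_transpose_natural; assumption)+

end
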